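(* Let $k$ be a commutative field and let $\mathcal{A}$ be a simple unital $k$-algebra which almost has finite dimensional representations. Then $\mathcal{A}$ is stably finite; that is, for every $n\geq 1$ and all $A,B\in\mathrm{Mat}_{n\times n}(\mathcal{A})$, if $AB=I$ then $BA=I$.
   Context: Algebras are associative, unital, not necessarily commutative. Simple means having no two-sided ideals other than $0$ and the whole (nonzero) algebra. Definition. Let $L$ be a finite dimensional subspace of a unital $k$-algebra $\mathcal{A}$ with $1\in L$, and let $\epsilon>0$. An $\epsilon$-almost representation of $L$ is a linear (not necessarily injective) map $\psi:L\to\mathrm{End}_k(V)$, where $V$ is a nonzero finite dimensional $k$-vector space, for which there is a subspace $V_\epsilon\subset V$ such that: $\psi(1)=I$; $\psi(a)\psi(b)(v)=\psi(ab)(v)$ whenever $a,b,ab\in L$ and $v\in V_\epsilon$; and $\frac{\dim_k V-\dim_k V_\epsilon}{\dim_k V}<\epsilon$. Definition. A unital $k$-algebra $\mathcal{A}$ almost has finite dimensional representations if for every finite dimensional subspace $L\subset\mathcal{A}$ with $1\in L$ and every $\epsilon>0$ there exists an $\epsilon$-almost representation of $L$. *)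

theory Defs
  imports "HOL-Library.Function_Algebras" "Jordan_Normal_Form.Matrix"
begin

text \<open>The ring axioms, including \<open>0 \<noteq> 1\<close>, come from class \<^class>\<open>ring_1\<close>; multiplication need not
  commute. The scalars are an arbitrary (commutative) field acting centrally.\<close>

locale unital_algebra = vector_space scale
  for scale :: "'k::field \<Rightarrow> 'a::ring_1 \<Rightarrow> 'a" +
  assumes scale_mult_left: "scale c x * y = scale c (x * y)"
    and scale_mult_right: "x * scale c y = scale c (x * y)"

text \<open>No condition on scalars is needed below: ring ideals of a unital algebra are closed under
  \<open>scale\<close>, because \<open>scale c x = scale c 1 * x\<close>.\<close>

definition two_sided_ideal :: "'a::ring_1 set \<Rightarrow> bool" where
  "two_sided_ideal I \<longleftrightarrow>
     0 \<in> I \<and> (\<forall>x\<in>I. \<forall>y\<in>I. x - y \<in> I) \<and> (\<forall>r. \<forall>x\<in>I. r * x \<in> I \<and> x * r \<in> I)"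

definition simple_algebra :: "'a::ring_1 itself \<Rightarrow> bool" where
  "simple_algebra _ \<longleftrightarrow> (\<forall>I :: 'a set. two_sided_ideal I \<longrightarrow> I = {0} \<or> I = UNIV)"

definition finite_dim_subspace :: "('k::field \<Rightarrow> 'v::ab_group_add \<Rightarrow> 'v) \<Rightarrow> 'v set \<Rightarrow> bool" where
  "finite_dim_subspace scale V \<longleftrightarrow>
     module.subspace scale V \<and> (\<exists>B. finite B \<and> module.span scale B = V)"

text \<open>Elements of \<open>End\<^sub>k(V)\<close> are represented by functions on the ambient type, of which only the
  values on \<open>V\<close> matter; all conditions are accordingly restricted to \<open>V\<close>.\<close>

definition linear_endo_on :: "('k::field \<Rightarrow> 'v::ab_group_add \<Rightarrow> 'v) \<Rightarrow> 'v set \<Rightarrow> ('v \<Rightarrow> 'v) \<Rightarrow> bool" where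
  "linear_endo_on scale V f \<longleftrightarrow>
     (\<forall>v\<in>V. f v \<in> V) \<and>
     (\<forall>v\<in>V. \<forall>w\<in>V. f (v + w) = f v + f w) \<and>
     (\<forall>c. \<forall>v\<in>V. f (scale c v) = scale c (f v))"

definition linear_map_to_End ::
  "('k::field \<Rightarrow> 'a::ab_group_add \<Rightarrow> 'a) \<Rightarrow> ('k \<Rightarrow> 'v::ab_group_add \<Rightarrow> 'v) \<Rightarrow>
   'a set \<Rightarrow> 'v set \<Rightarrow> ('a \<Rightarrow> 'v \<Rightarrow> 'v) \<Rightarrow> bool" where
  "linear_map_to_End scaleA scaleV L V \<psi> \<longleftrightarrow>
     (\<forall>a\<in>L. linear_endo_on scaleV V (\<psi> a)) \<and>
     (\<forall>a\<in>L. \<forall>b\<in>L. \<forall>v\<in>V. \<psi> (a + b) v = \<psi> a v + \<psi> b v) \<and>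
     (\<forall>c. \<forall>a\<in>L. \<forall>v\<in>V. \<psi> (scaleA c a) v = scaleV c (\<psi> a v))"

definition almost_representation ::
  "('k::field \<Rightarrow> 'a::ring_1 \<Rightarrow> 'a) \<Rightarrow> ('k \<Rightarrow> 'v::ab_group_add \<Rightarrow> 'v) \<Rightarrow>
   real \<Rightarrow> 'a set \<Rightarrow> 'v set \<Rightarrow> ('a \<Rightarrow> 'v \<Rightarrow> 'v) \<Rightarrow> bool" where
  "almost_representation scaleA scaleV \<epsilon> L V \<psi> \<longleftrightarrow>
     finite_dim_subspace scaleV V \<and> V \<noteq> {0} \<and>
     linear_map_to_End scaleA scaleV L V \<psi> \<and>
     (\<exists>V\<epsilon>. module.subspace scaleV V\<epsilon> \<and> V\<epsilon> \<subseteq> V \<and>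
        (\<forall>v\<in>V. \<psi> 1 v = v) \<and>
        (\<forall>a\<in>L. \<forall>b\<in>L. a * b \<in> L \<longrightarrow> (\<forall>v\<in>V\<epsilon>. \<psi> a (\<psi> b v) = \<psi> (a * b) v)) \<and>
        (real (vector_space.dim scaleV V) - real (vector_space.dim scaleV V\<epsilon>))
          / real (vector_space.dim scaleV V) < \<epsilon>)"

text \<open>HOL cannot quantify over all types carrying a vector space. The space \<open>V\<close> therefore ranges over
  the finite dimensional subspaces of \<open>nat \<Rightarrow> 'k\<close>, which up to isomorphism are all finite
  dimensional \<open>'k\<close>-vector spaces; \<open>almost_representation_transfer\<close> below shows that nothing is lost.\<close>

definition fun_scale :: "'k::field \<Rightarrow> (nat \<Rightarrow> 'k) \<Rightarrow> (nat \<Rightarrow> 'k)" where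
  "fun_scale c f = (\<lambda>i. c * f i)"

definition almost_has_finite_dim_reps :: "('k::field \<Rightarrow> 'a::ring_1 \<Rightarrow> 'a) \<Rightarrow> bool" where
  "almost_has_finite_dim_reps scale \<longleftrightarrow>
     (\<forall>L \<epsilon>. finite_dim_subspace scale L \<and> 1 \<in> L \<and> 0 < \<epsilon> \<longrightarrow>
        (\<exists>V \<psi>. almost_representation scale fun_scale \<epsilon> L V \<psi>))"

definition stably_finite :: "'a::ring_1 itself \<Rightarrow> bool" where
  "stably_finite _ \<longleftrightarrow>
     (\<forall>n\<ge>1. \<forall>A \<in> carrier_mat n n. \<forall>B \<in> carrier_mat n n.
        (A :: 'a mat) * B = 1\<^sub>m n \<longrightarrow> B * A = 1\<^sub>m n)"

lemma vector_space_fun_scale: "vector_space fun_scale"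
  by unfold_locales (auto simp: fun_scale_def fun_eq_iff algebra_simps)

lemma almost_representation_transfer:
  fixes scaleV :: "'k::field \<Rightarrow> 'v::ab_group_add \<Rightarrow> 'v"
  assumes "vector_space scaleV"
    and rep: "almost_representation scaleA scaleV \<epsilon> L V \<psi>"
  shows "\<exists>W \<phi>. almost_representation scaleA fun_scale \<epsilon> L W \<phi>"
proof -
  interpret V: vector_space scaleV by fact
  interpret F: vector_space fun_scale by (rule vector_space_fun_scale)
  interpret VF: vector_space_pair scaleV fun_scale ..
  from rep obtain V\<epsilon> where
    subV: "V.subspace V" and fdV: "\<exists>B. finite B \<and> V.span B = V" and V0: "V \<noteq> {0}"
    and lin: "linear_map_to_End scaleA scaleV L V \<psi>"
    and sub\<epsilon>: "V.subspace V\<epsilon>" "V\<epsilon> \<subseteq> V" and one: "\<And>v. v \<in> V \<Longrightarrow> \<psi> 1 v = v"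
    and mult: "\<And>a b v. a \<in> L \<Longrightarrow> b \<in> L \<Longrightarrow> a * b \<in> L \<Longrightarrow> v \<in> V\<epsilon> \<Longrightarrow> \<psi> a (\<psi> b v) = \<psi> (a * b) v"
    and small: "(real (V.dim V) - real (V.dim V\<epsilon>)) / real (V.dim V) < \<epsilon>"
    unfolding almost_representation_def finite_dim_subspace_def by blast
  obtain B where B: "B \<subseteq> V" "V.independent B" "V \<subseteq> V.span B" "card B = V.dim V"
    using V.basis_exists by blast
  have spanB: "V.span B = V"
    using B subV by (simp add: V.span_subspace)
  have finB: "finite B"
    using fdV B V.independent_span_bound by blast
  obtain h :: "'v \<Rightarrow> nat" where h: "inj_on h B"
    using finB finite_imp_inj_to_nat_seg by metis
  define \<delta> :: "'v \<Rightarrow> nat \<Rightarrow> 'k" where "\<delta> b = (\<lambda>i. if i = h b then 1 else 0)" for b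
  obtain e where e: "Vector_Spaces.linear scaleV fun_scale e" and eB: "\<And>b. b \<in> B \<Longrightarrow> e b = \<delta> b"
    using VF.linear_independent_extend[OF B(2), of \<delta>] by blast
  interpret e: Vector_Spaces.linear scaleV fun_scale e by (rule e)
  have sum_app: "(\<Sum>b\<in>A. f b) i = (\<Sum>b\<in>A. f b i)" for A :: "'v set" and f :: "'v \<Rightarrow> nat \<Rightarrow> 'k" and i
    by (induction A rule: infinite_finite_induct) auto
  have e_coord: "e v (h b) = V.representation B v b" if "v \<in> V" "b \<in> B" for v b
  proof -
    have "e v = e (\<Sum>c\<in>B. scaleV (V.representation B v c) c)"
      using V.sum_representation_eq[OF B(2) _ finB subset_refl] that spanB by simp
    also have "\<dots> = (\<Sum>c\<in>B. fun_scale (V.representation B v c) (\<delta> c))"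
      by (simp add: e.sum e.scale eB)
    finally have "e v (h b) = (\<Sum>c\<in>B. V.representation B v c * \<delta> c (h b))"
      by (simp add: sum_app fun_scale_def)
    also have "\<dots> = (\<Sum>c\<in>B. if c = b then V.representation B v c else 0)"
      using that(2) inj_onD[OF h] by (intro sum.cong) (auto simp: \<delta>_def)
    also have "\<dots> = V.representation B v b"
      using finB that(2) by simp
    finally show ?thesis .
  qed
  have inj: "inj_on e V"
  proof (rule inj_onI)
    fix v w assume vw: "v \<in> V" "w \<in> V" "e v = e w"
    then have "V.representation B v b = V.representation B w b" if "b \<in> B" for b
      using e_coord that by metis
    then have "(\<Sum>b\<in>B. scaleV (V.representation B v b) b) = (\<Sum>b\<in>B. scaleV (V.representation B w b) b)"
      by simp
    then show "v = w"
      using V.sum_representation_eq[OF B(2) _ finB subset_refl] vw spanB by simp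
  qed
  have dim: "F.dim (e ` S) = V.dim S" if S: "V.subspace S" "S \<subseteq> V" for S
  proof -
    obtain C where C: "C \<subseteq> S" "V.independent C" "S \<subseteq> V.span C" "card C = V.dim S"
      using V.basis_exists by blast
    have spanC: "V.span C = S"
      using C S(1) by (simp add: V.span_subspace)
    have injC: "inj_on e (V.span C)"
      using inj S(2) spanC inj_on_subset by metis
    have "F.independent (e ` C)"
      by (rule e.independent_injective_image[OF C(2) injC])
    moreover have "F.span (e ` C) = e ` S"
      by (simp add: e.span_image spanC)
    ultimately have "F.dim (e ` S) = card (e ` C)"
      by (metis F.dim_span_eq_card_independent)
    also have "\<dots> = card C"
      using injC by (intro card_image inj_on_subset[OF injC]) (simp add: V.span_superset)
    finally show ?thesis using C(4) by simp
  qed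
  define p where "p = the_inv_into V e"
  have p: "p (e v) = v" if "v \<in> V" for v
    using the_inv_into_f_f[OF inj that] by (simp add: p_def)
  define \<phi> where "\<phi> a w = e (\<psi> a (p w))" for a w
  have \<phi>: "\<phi> a (e v) = e (\<psi> a v)" if "v \<in> V" for a v
    using p[OF that] by (simp add: \<phi>_def)
  have Vadd: "v + w \<in> V" and Vscale: "scaleV c v \<in> V" if "v \<in> V" "w \<in> V" for v w c
    using subV that by (auto simp: V.subspace_add V.subspace_scale)
  have \<psi>V: "\<psi> a v \<in> V" if "a \<in> L" "v \<in> V" for a v
    using lin that by (auto simp: linear_map_to_End_def linear_endo_on_def)
  have \<psi>_lin: "\<psi> a (v + w) = \<psi> a v + \<psi> a w" "\<psi> a (scaleV c v) = scaleV c (\<psi> a v)"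
    if "a \<in> L" "v \<in> V" "w \<in> V" for a v w c
    using lin that by (auto simp: linear_map_to_End_def linear_endo_on_def)
  have \<psi>_add: "\<psi> (a + b) v = \<psi> a v + \<psi> b v" if "a \<in> L" "b \<in> L" "v \<in> V" for a b v
    using lin that by (auto simp: linear_map_to_End_def)
  have \<psi>_scale: "\<psi> (scaleA c a) v = scaleV c (\<psi> a v)" if "a \<in> L" "v \<in> V" for a c v
    using lin that by (auto simp: linear_map_to_End_def)
  have linW: "linear_map_to_End scaleA fun_scale L (e ` V) \<phi>"
    unfolding linear_map_to_End_def linear_endo_on_def
    by (auto simp: \<phi> \<psi>V \<psi>_lin \<psi>_add \<psi>_scale Vadd Vscale simp flip: e.add e.scale)
  have fdW: "finite_dim_subspace fun_scale (e ` V)"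
    unfolding finite_dim_subspace_def
    using finB spanB e.span_image[of B] subV e.subspace_image by (metis finite_imageI)
  have W0: "e ` V \<noteq> {0}"
  proof
    assume W: "e ` V = {0}"
    have "0 \<in> V" using subV by (rule V.subspace_0)
    have "v = 0" if "v \<in> V" for v
      using inj_onD[OF inj, of v 0] W that \<open>0 \<in> V\<close> by auto
    then show False using V0 \<open>0 \<in> V\<close> by auto
  qed
  have "almost_representation scaleA fun_scale \<epsilon> L (e ` V) \<phi>"
    unfolding almost_representation_def
  proof (intro conjI exI[of _ "e ` V\<epsilon>"])
    show "F.subspace (e ` V\<epsilon>)"
      using sub\<epsilon>(1) by (rule e.subspace_image)
    show "e ` V\<epsilon> \<subseteq> e ` V"
      using sub\<epsilon>(2) by blast
    show "\<forall>v\<in>e ` V. \<phi> 1 v = v"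
      by (auto simp: \<phi> one)
    show "\<forall>a\<in>L. \<forall>b\<in>L. a * b \<in> L \<longrightarrow> (\<forall>v\<in>e ` V\<epsilon>. \<phi> a (\<phi> b v) = \<phi> (a * b) v)"
      using sub\<epsilon>(2) by (auto simp: \<phi> \<psi>V mult subset_iff)
    show "(real (F.dim (e ` V)) - real (F.dim (e ` V\<epsilon>))) / real (F.dim (e ` V)) < \<epsilon>"
      using small dim[OF subV subset_refl] dim[OF sub\<epsilon>] by simp
  qed (use fdW W0 linW in auto)
  then show ?thesis by blast
qed

end

theory Submission
  imports Defs
begin

text \<open>If \<open>A B = 1\<close> but \<open>B A \<noteq> 1\<close>, some entry \<open>c\<close> of \<open>1 - B A\<close> is nonzero, so simplicity gives
  \<open>x\<^sub>1 c y\<^sub>1 + \<dots> + x\<^sub>m c y\<^sub>m = 1\<close>. Let \<open>\<psi>\<close> be an \<open>\<epsilon>\<close>-almost representation of a space containing all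
  elements involved, multiplicative on \<open>U \<subseteq> V\<close>. On \<open>U\<^sup>n\<close> the operator \<open>\<psi>(A) \<psi>(B)\<close> is the identity, so
  \<open>\<psi>(1 - B A)\<close> vanishes on \<open>\<psi>(B) U\<^sup>n \<inter> U\<^sup>n\<close> and has rank less than \<open>2 n \<epsilon> dim V\<close>; the same bound holds
  for \<open>\<psi>(c)\<close>. Every \<open>u \<in> U\<close> equals \<open>\<Sum>\<^sub>i \<psi>(x\<^sub>i) \<psi>(c) \<psi>(y\<^sub>i) u\<close>, hence
  \<open>(1 - \<epsilon>) dim V < dim U \<le> m rank \<psi>(c)\<close>, which is absurd for \<open>\<epsilon> = 1 / (2 m n + 1)\<close>.\<close>

section \<open>Finite dimensional subspaces\<close>

context vector_space
begin

text \<open>\<open>dim\<close> counts a basis and therefore returns 0 in infinite dimension, so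
  finiteness is carried along explicitly. This rule supplies a finite basis that realises
  \<open>dim\<close>.\<close>

lemma finite_dim_subspaceE:
  assumes "finite_dim_subspace scale S"
  obtains B where "finite B" "B \<subseteq> S" "independent B" "span B = S" "card B = dim S"
proof -
  from assms obtain F where S: "subspace S" and F: "finite F" "span F = S"
    unfolding finite_dim_subspace_def by blast
  obtain B where B: "B \<subseteq> S" "independent B" "S \<subseteq> span B" "card B = dim S"
    using basis_exists by blast
  moreover have "finite B"
    using B F independent_span_bound by blast
  ultimately show thesis
    using that S by (metis span_subspace)
qed

lemma finite_dim_subspace_subset:
  assumes S: "finite_dim_subspace scale S" and T: "subspace T" "T \<subseteq> S"
  shows "finite_dim_subspace scale T" and "dim T \<le> dim S"
proof -
  obtain B where B: "finite B" "span B = S" "card B = dim S"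
    using S by (rule finite_dim_subspaceE)
  obtain C where C: "C \<subseteq> T" "independent C" "T \<subseteq> span C" "card C = dim T"
    using basis_exists by blast
  have "finite C"
    using independent_span_bound[OF B(1) C(2)] C(1) T(2) B(2) by blast
  then show "finite_dim_subspace scale T"
    unfolding finite_dim_subspace_def using T C by (metis span_subspace)
  show "dim T \<le> dim S"
    using dim_le_card[of T B] B T by simp
qed

end

section \<open>Rank and nullity inequalities\<close>

context vector_space_pair
begin

lemma dim_image_add_dim_kernel_le:
  assumes f: "Vector_Spaces.linear s1 s2 f" and S: "finite_dim_subspace s1 S"
  shows "finite_dim_subspace s2 (f ` S)"
    and "vs2.dim (f ` S) + vs1.dim {x \<in> S. f x = 0} \<le> vs1.dim S"
proof -
  interpret f: Vector_Spaces.linear s1 s2 f by (rule f)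
  let ?K = "{x \<in> S. f x = 0}"
  have subS: "vs1.subspace S" using S by (simp add: finite_dim_subspace_def)
  obtain F where F: "finite F" "F \<subseteq> S" "vs1.span F = S"
    using S by (rule vs1.finite_dim_subspaceE)
  show "finite_dim_subspace s2 (f ` S)"
    unfolding finite_dim_subspace_def
    using f.subspace_image[OF subS] f.span_image[of F] F by (metis finite_imageI)
  obtain D where D: "D \<subseteq> ?K" "vs1.independent D" "?K \<subseteq> vs1.span D" "card D = vs1.dim ?K"
    using vs1.basis_exists by blast
  obtain E where E: "D \<subseteq> E" "E \<subseteq> S" "vs1.independent E" "S \<subseteq> vs1.span E"
    using vs1.maximal_independent_subset_extend[of D S] D by auto
  have finE: "finite E"
    using vs1.independent_span_bound[OF F(1) E(3)] E F by auto
  have cardE: "card E = vs1.dim S"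
    using E by (intro vs1.basis_card_eq_dim)
  have "f ` S \<subseteq> vs2.span (f ` (E - D))"
  proof -
    have "f ` S \<subseteq> vs2.span (f ` E)"
      using E(4) by (auto simp: f.span_image)
    also have "f ` E \<subseteq> insert 0 (f ` (E - D))"
      using D(1) by auto
    then have "vs2.span (f ` E) \<subseteq> vs2.span (f ` (E - D))"
      using vs2.span_mono vs2.span_insert_0 by metis
    finally show ?thesis .
  qed
  then have "vs2.dim (f ` S) \<le> card (f ` (E - D))"
    using finE by (intro vs2.dim_le_card) auto
  also have "\<dots> \<le> card (E - D)"
    using finE by (simp add: card_image_le)
  also have "\<dots> = card E - card D"
    using finE E(1) finite_subset by (intro card_Diff_subset) auto
  finally show "vs2.dim (f ` S) + vs1.dim ?K \<le> vs1.dim S"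
    using card_mono[OF finE E(1)] cardE D(4) by simp
qed

text \<open>The other half of rank-nullity: preimages \<open>C\<close> of a basis of the image,
  together with a basis \<open>D\<close> of the kernel, span \<open>S\<close>. Finite dimension of
  \<open>S\<close> is a conclusion here, which allows induction on direct powers.\<close>

lemma dim_le_dim_image_add_dim_kernel:
  assumes f: "Vector_Spaces.linear s1 s2 f" and S: "vs1.subspace S"
    and fS: "finite_dim_subspace s2 (f ` S)"
    and K: "finite_dim_subspace s1 {x \<in> S. f x = 0}"
  shows "finite_dim_subspace s1 S"
    and "vs1.dim S \<le> vs2.dim (f ` S) + vs1.dim {x \<in> S. f x = 0}"
proof -
  interpret f: Vector_Spaces.linear s1 s2 f by (rule f)
  let ?K = "{x \<in> S. f x = 0}"
  obtain B where B: "finite B" "B \<subseteq> f ` S" "vs2.span B = f ` S" "card B = vs2.dim (f ` S)"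
    using fS by (rule vs2.finite_dim_subspaceE)
  obtain D where D: "finite D" "D \<subseteq> ?K" "vs1.span D = ?K" "card D = vs1.dim ?K"
    using K by (rule vs1.finite_dim_subspaceE)
  obtain C where C: "C \<subseteq> S" "finite C" "B = f ` C" "card C = card B"
    using B(1,2) by (metis card_image finite_imageD subset_image_inj)
  have span: "vs1.span (C \<union> D) = S"
  proof
    show "vs1.span (C \<union> D) \<subseteq> S"
      using C(1) D(2) S by (intro vs1.span_minimal) auto
    show "S \<subseteq> vs1.span (C \<union> D)"
    proof
      fix x assume x: "x \<in> S"
      have "f x \<in> f ` vs1.span C"
        using x B(3) C(3) by (simp flip: f.span_image)
      then obtain y where y: "y \<in> vs1.span C" "f x = f y" by blast
      have "y \<in> S"
        using y(1) C(1) S vs1.span_minimal by blast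
      then have "x - y \<in> vs1.span D"
        using x y S D(3) by (simp add: f.diff vs1.subspace_diff)
      then have "y + (x - y) \<in> vs1.span (C \<union> D)"
        using y(1) vs1.span_mono[of C "C \<union> D"] vs1.span_mono[of D "C \<union> D"]
        by (intro vs1.span_add) auto
      then show "x \<in> vs1.span (C \<union> D)" by simp
    qed
  qed
  then show "finite_dim_subspace s1 S"
    unfolding finite_dim_subspace_def using S C(2) D(1) by (metis finite_UnI)
  have "vs1.dim S \<le> card (C \<union> D)"
    using span C(2) D(1) by (intro vs1.dim_le_card) auto
  also have "\<dots> \<le> card C + card D"
    by (rule card_Un_le)
  finally show "vs1.dim S \<le> vs2.dim (f ` S) + vs1.dim ?K"
    using B(4) C(4) D(4) by simp
qed

text \<open>The images of one finite basis of \<open>R\<close> under all the \<open>f i\<close> span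
  a space containing \<open>U\<close>.\<close>

lemma dim_le_sum_images:
  assumes f: "\<And>i. i \<in> I \<Longrightarrow> Vector_Spaces.linear s1 s2 (f i)" and "finite I"
    and R: "finite_dim_subspace s1 R"
    and U: "\<And>u. u \<in> U \<Longrightarrow> \<exists>r. (\<forall>i\<in>I. r i \<in> R) \<and> u = (\<Sum>i\<in>I. f i (r i))"
  shows "vs2.dim U \<le> card I * vs1.dim R"
proof -
  obtain B where B: "finite B" "B \<subseteq> R" "vs1.span B = R" "card B = vs1.dim R"
    using R by (rule vs1.finite_dim_subspaceE)
  let ?G = "\<Union>i\<in>I. f i ` B"
  have "U \<subseteq> vs2.span ?G"
  proof
    fix u assume "u \<in> U"
    then obtain r where r: "\<And>i. i \<in> I \<Longrightarrow> r i \<in> R" "u = (\<Sum>i\<in>I. f i (r i))"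
      using U by blast
    have "f i (r i) \<in> vs2.span ?G" if i: "i \<in> I" for i
    proof -
      interpret f: Vector_Spaces.linear s1 s2 "f i" by (rule f[OF i])
      have "f i (r i) \<in> vs2.span (f i ` B)"
        using r(1)[OF i] B(3) by (simp add: f.span_image)
      then show ?thesis
        using vs2.span_mono[of "f i ` B" ?G] i by blast
    qed
    then show "u \<in> vs2.span ?G"
      unfolding r(2) by (rule vs2.span_sum)
  qed
  then have "vs2.dim U \<le> card ?G"
    using B(1) \<open>finite I\<close> by (intro vs2.dim_le_card) auto
  also have "\<dots> \<le> (\<Sum>i\<in>I. card (f i ` B))"
    using \<open>finite I\<close> by (rule card_UN_le)
  also have "\<dots> \<le> (\<Sum>i\<in>I. card B)"
    by (intro sum_mono card_image_le B(1))
  finally show ?thesis using B(4) by simp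
qed

text \<open>Prescribe \<open>g\<close> by \<open>f\<close> on a basis of \<open>V\<close>. This
  turns an endomorphism known only on \<open>V\<close> into a linear map of the ambient type, the
  form that the rank inequalities require.\<close>

lemma linear_on_subspace_extend:
  assumes V: "vs1.subspace V"
    and add: "\<And>v w. v \<in> V \<Longrightarrow> w \<in> V \<Longrightarrow> f (v + w) = f v + f w"
    and scale: "\<And>c v. v \<in> V \<Longrightarrow> f (s1 c v) = s2 c (f v)"
  shows "\<exists>g. Vector_Spaces.linear s1 s2 g \<and> (\<forall>v\<in>V. g v = f v)"
proof -
  obtain B where B: "B \<subseteq> V" "vs1.independent B" "V \<subseteq> vs1.span B"
    using vs1.basis_exists by blast
  obtain g where g: "Vector_Spaces.linear s1 s2 g" "\<And>b. b \<in> B \<Longrightarrow> g b = f b"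
    using linear_independent_extend[OF B(2), of f] by blast
  interpret g: Vector_Spaces.linear s1 s2 g by (rule g)
  have f0: "f 0 = 0"
    using scale[of 0 0] vs1.subspace_0[OF V] by simp
  \<comment> \<open>Membership in \<open>V\<close> is part of the induction claim because
    \<open>f\<close> is additive and homogeneous only there.\<close>
  have "v \<in> V \<and> g v = f v" if "v \<in> vs1.span B" for v
    using that
  proof (induction rule: vs1.span_induct_alt)
    case base
    then show ?case using f0 vs1.subspace_0[OF V] by (simp add: g.zero)
  next
    case (step c x y)
    moreover from this have "s1 c x \<in> V"
      using B(1) V by (auto intro: vs1.subspace_scale)
    ultimately show ?case
      using B(1) V by (auto simp: g.add g.scale add scale g(2) subsetD vs1.subspace_add)
  qed
  then show ?thesis using g(1) B(3) by blast
qed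

end

text \<open>\<open>P\<close> plays the role of the quotient map modulo \<open>U\<close>: its kernel
  is \<open>U\<close>, so its rank on \<open>X\<close> is at most \<open>dim X - dim U\<close>,
  while its kernel on \<open>W\<close> is \<open>W \<inter> U\<close>. Comparing \<open>P\<close>
  W\<open>with\<close>P \<open>X\<close> gives the bound.\<close>

lemma (in vector_space) dim_le_dim_Int:
  assumes X: "finite_dim_subspace scale X"
    and U: "subspace U" "U \<subseteq> X" and W: "subspace W" "W \<subseteq> X"
  shows "dim U + dim W \<le> dim X + dim (W \<inter> U)"
proof -
  interpret VV: vector_space_pair scale scale ..
  have "Vector_Spaces.linear scale scale id" by (rule linear_id)
  \<comment> \<open>A left inverse of the identity on \<open>U\<close> is a linear projection of the
    ambient space onto \<open>U\<close>.\<close>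
  then obtain Q where Q: "Q ` UNIV \<subseteq> U" "Vector_Spaces.linear scale scale Q" "\<And>u. u \<in> U \<Longrightarrow> Q u = u"
    using VV.linear_exists_left_inverse_on[of id U] U(1) by auto
  define P where "P x = x - Q x" for x
  have P: "Vector_Spaces.linear scale scale P"
    unfolding P_def by (intro VV.linear_compose_sub linear_ident Q)
  have kerP: "P x = 0 \<longleftrightarrow> x \<in> U" for x
    using Q(1,3) by (auto simp: P_def)
  have "{x \<in> X. P x = 0} = U" "{x \<in> W. P x = 0} = W \<inter> U"
    using U(2) kerP by auto
  moreover note VV.dim_image_add_dim_kernel_le[OF P X]
  moreover have fdW: "finite_dim_subspace scale W"
    using X W by (rule finite_dim_subspace_subset)
  moreover have "finite_dim_subspace scale (W \<inter> U)"
    using fdW subspace_inter[OF W(1) U(1)] by (rule finite_dim_subspace_subset) simp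
  moreover have "subspace (P ` W)"
    using P W(1) by (rule VV.linear_subspace_image)
  ultimately have "dim (P ` X) + dim U \<le> dim X" "dim W \<le> dim (P ` W) + dim (W \<inter> U)"
    "dim (P ` W) \<le> dim (P ` X)"
    using VV.dim_le_dim_image_add_dim_kernel[OF P W(1)] VV.dim_image_add_dim_kernel_le[OF P fdW]
      finite_dim_subspace_subset(2)[of "P ` X" "P ` W"] W(2) by auto
  then show ?thesis by simp
qed

text \<open>The finite dimensional core: \<open>C\<close> vanishes on \<open>S ` U \<inter> U\<close>, an intersection of two subspaces
  of dimension \<open>dim U\<close>.\<close>

lemma (in vector_space) dim_image_defect_le:
  assumes X: "finite_dim_subspace scale X" and U: "subspace U" "U \<subseteq> X"
    and S: "Vector_Spaces.linear scale scale S" "S ` U \<subseteq> X"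
    and T: "Vector_Spaces.linear scale scale T" "\<And>u. u \<in> U \<Longrightarrow> T (S u) = u"
    and C: "Vector_Spaces.linear scale scale C" "\<And>u. u \<in> U \<Longrightarrow> C u = u - S (T u)"
  shows "dim (C ` X) + 2 * dim U \<le> 2 * dim X"
proof -
  interpret VV: vector_space_pair scale scale ..
  interpret C: Vector_Spaces.linear scale scale C by (rule C)
  let ?W = "S ` U"
  have W: "subspace ?W"
    using S(1) U(1) by (rule VV.linear_subspace_image)
  have fdW: "finite_dim_subspace scale ?W"
    using X W S(2) by (rule finite_dim_subspace_subset)
  \<comment> \<open>\<open>T\<close> undoes \<open>S\<close> on \<open>U\<close>, so
    \<open>S\<close> loses no dimension there.\<close>
  have "T ` ?W = U"
    using T(2) by (auto simp: image_image)
  then have "dim U \<le> dim ?W"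
    using VV.dim_image_add_dim_kernel_le(2)[OF T(1) fdW] by simp
  moreover have "dim U + dim ?W \<le> dim X + dim (?W \<inter> U)"
    using X U W S(2) by (rule dim_le_dim_Int)
  moreover have "dim (?W \<inter> U) \<le> dim {x \<in> X. C x = 0}"
  proof (rule finite_dim_subspace_subset)
    have "subspace {x \<in> X. C x = 0}"
      using X C.subspace_kernel subspace_inter
      by (auto simp: finite_dim_subspace_def Collect_conj_eq)
    then show "finite_dim_subspace scale {x \<in> X. C x = 0}"
      using X by (auto intro: finite_dim_subspace_subset)
    show "subspace (?W \<inter> U)"
      using W U(1) by (rule subspace_inter)
    \<comment> \<open>If \<open>w = S u\<close> lies in \<open>U\<close> with \<open>u\<close> in
      \<open>U\<close>, then \<open>T w = u\<close>, whence
      \<open>C w = w - S u = 0\<close>.\<close>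
    show "?W \<inter> U \<subseteq> {x \<in> X. C x = 0}"
      using U(2) C(2) T(2) by auto
  qed
  ultimately show ?thesis
    using VV.dim_image_add_dim_kernel_le(2)[OF C(1) X] by simp
qed

section \<open>Direct powers\<close>

definition seq_scale :: "('k \<Rightarrow> 'v \<Rightarrow> 'v) \<Rightarrow> 'k \<Rightarrow> (nat \<Rightarrow> 'v) \<Rightarrow> nat \<Rightarrow> 'v" where
  "seq_scale s c f = (\<lambda>i. s c (f i))"

text \<open>The power of \<open>S\<close> with exponent \<open>n\<close>, realised in one sequence
  type for all \<open>n\<close>. Forcing zeros from index \<open>n\<close> on keeps it finite
  dimensional when \<open>S\<close> is.\<close>

definition direct_power :: "nat \<Rightarrow> 'v::zero set \<Rightarrow> (nat \<Rightarrow> 'v) set" where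
  "direct_power n S = {f. (\<forall>i<n. f i \<in> S) \<and> (\<forall>i\<ge>n. f i = 0)}"

text \<open>A matrix of operators acting on column vectors. The value 0 outside the range matches
  the padding of \<open>direct_power\<close>.\<close>

definition matrix_act ::
  "nat \<Rightarrow> (nat \<Rightarrow> nat \<Rightarrow> 'v \<Rightarrow> 'v) \<Rightarrow> (nat \<Rightarrow> 'v) \<Rightarrow> nat \<Rightarrow> 'v::ab_group_add" where
  "matrix_act n M f = (\<lambda>i. if i < n then \<Sum>j<n. M i j (f j) else 0)"

context vector_space
begin

lemma vector_space_seq_scale: "vector_space (seq_scale scale)"
  by unfold_locales
    (auto simp: seq_scale_def fun_eq_iff scale_right_distrib scale_left_distrib)

lemma linear_component: "Vector_Spaces.linear (seq_scale scale) scale (\<lambda>f. f i)"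
proof -
  interpret P: vector_space "seq_scale scale" by (rule vector_space_seq_scale)
  show ?thesis
    by unfold_locales (auto simp: seq_scale_def)
qed

lemma subspace_direct_power:
  assumes "subspace S"
  shows "module.subspace (seq_scale scale) (direct_power n S)"
proof -
  interpret P: vector_space "seq_scale scale" by (rule vector_space_seq_scale)
  show ?thesis
    using assms by (auto simp: P.subspace_def subspace_def direct_power_def seq_scale_def)
qed

text \<open>Induction on \<open>n\<close>: the coordinate map at index \<open>n\<close> sends the
  power with exponent \<open>Suc n\<close> onto \<open>S\<close>, and its kernel is the power with
  exponent \<open>n\<close>.\<close>

lemma
  assumes S: "finite_dim_subspace scale S"
  shows finite_dim_direct_power: "finite_dim_subspace (seq_scale scale) (direct_power n S)"
    and dim_direct_power: "vector_space.dim (seq_scale scale) (direct_power n S) = n * dim S"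
proof -
  interpret P: vector_space "seq_scale scale" by (rule vector_space_seq_scale)
  interpret PV: vector_space_pair "seq_scale scale" scale ..
  have subS: "subspace S" using S by (simp add: finite_dim_subspace_def)
  then have S0: "0 \<in> S" by (rule subspace_0)
  have "finite_dim_subspace (seq_scale scale) (direct_power n S) \<and> P.dim (direct_power n S) = n * dim S"
  proof (induction n)
    case 0
    have "direct_power 0 S = P.span {}"
      by (auto simp: direct_power_def)
    moreover have "P.dim (P.span {}) = 0"
      by (subst P.dim_span_eq_card_independent) (rule P.independent_empty, simp)
    ultimately show ?case
      by (auto simp: finite_dim_subspace_def simp del: P.span_empty)
  next
    case (Suc n)
    let ?D = "direct_power (Suc n) S"
    have im: "(\<lambda>f. f n) ` ?D = S"
    proof
      show "S \<subseteq> (\<lambda>f. f n) ` ?D"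
      proof
        fix v assume "v \<in> S"
        then have "(\<lambda>i. if i = n then v else 0) \<in> ?D"
          using S0 by (auto simp: direct_power_def)
        then show "v \<in> (\<lambda>f. f n) ` ?D" by (rule rev_image_eqI) simp
      qed
    qed (auto simp: direct_power_def)
    have ker: "{f \<in> ?D. f n = 0} = direct_power n S"
    proof -
      have "(\<forall>i\<ge>n. f i = 0) \<longleftrightarrow> f n = 0 \<and> (\<forall>i\<ge>Suc n. f i = 0)" for f :: "nat \<Rightarrow> 'b"
        by (metis Suc_leD le_antisym le_refl not_less_eq_eq)
      then show ?thesis
        using S0 by (auto simp: direct_power_def less_Suc_eq)
    qed
    \<comment> \<open>\<open>le\<close> also provides the finite dimension of \<open>?D\<close> that
      \<open>ge\<close> presupposes; together the two bounds give the exact dimension.\<close>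
    note le = PV.dim_le_dim_image_add_dim_kernel
        [OF linear_component subspace_direct_power[OF subS, of "Suc n"], of n, unfolded im ker]
    note ge = PV.dim_image_add_dim_kernel_le(2)[OF linear_component, of ?D n, unfolded im ker]
    show ?case
      using le ge S Suc by simp
  qed
  then show "finite_dim_subspace (seq_scale scale) (direct_power n S)"
    "P.dim (direct_power n S) = n * dim S" by auto
qed

lemma linear_matrix_act:
  assumes "\<And>i j. i < n \<Longrightarrow> j < n \<Longrightarrow> Vector_Spaces.linear scale scale (M i j)"
  shows "Vector_Spaces.linear (seq_scale scale) (seq_scale scale) (matrix_act n M)"
proof -
  interpret P: vector_space "seq_scale scale" by (rule vector_space_seq_scale)
  have "M i j (v + w) = M i j v + M i j w" "M i j (scale c v) = scale c (M i j v)"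
    if "i < n" "j < n" for i j c v w
    using assms[OF that] by (simp_all add: Vector_Spaces.linear_iff)
  then show ?thesis
    by (auto simp: Vector_Spaces.linear_iff P.vector_space_axioms matrix_act_def seq_scale_def fun_eq_iff
        sum.distrib scale_sum_right)
qed

end

section \<open>Almost representations by linear maps of the ambient space\<close>

text \<open>An almost representation whose operators are linear on the whole ambient space, so that
  the rank inequalities apply to them directly. \<open>U\<close> is the subspace on which products
  are respected; its codimension is estimated outside the locale.\<close>

locale linear_almost_rep =
  A: vector_space scaleA + V: vector_space scaleV
  for scaleA :: "'k::field \<Rightarrow> 'a::ring_1 \<Rightarrow> 'a" and scaleV :: "'k \<Rightarrow> 'v::ab_group_add \<Rightarrow> 'v" +
  fixes L :: "'a set" and V U :: "'v set" and \<phi> :: "'a \<Rightarrow> 'v \<Rightarrow> 'v"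
  assumes L: "A.subspace L" and one_L: "1 \<in> L"
    and V: "finite_dim_subspace scaleV V"
    and U: "V.subspace U" "U \<subseteq> V"
    and linear: "a \<in> L \<Longrightarrow> Vector_Spaces.linear scaleV scaleV (\<phi> a)"
    and closed: "a \<in> L \<Longrightarrow> v \<in> V \<Longrightarrow> \<phi> a v \<in> V"
    and add: "a \<in> L \<Longrightarrow> b \<in> L \<Longrightarrow> v \<in> V \<Longrightarrow> \<phi> (a + b) v = \<phi> a v + \<phi> b v"
    and scale: "a \<in> L \<Longrightarrow> v \<in> V \<Longrightarrow> \<phi> (scaleA c a) v = scaleV c (\<phi> a v)"
    and one: "v \<in> V \<Longrightarrow> \<phi> 1 v = v"
    and mult: "a \<in> L \<Longrightarrow> b \<in> L \<Longrightarrow> a * b \<in> L \<Longrightarrow> v \<in> U \<Longrightarrow> \<phi> a (\<phi> b v) = \<phi> (a * b) v"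
begin

lemma V_subspace: "V.subspace V"
  using V by (simp add: finite_dim_subspace_def)

lemma zero: "v \<in> V \<Longrightarrow> \<phi> 0 v = 0"
  using scale[of 0 v 0] A.subspace_0[OF L] by simp

lemma diff: "a \<in> L \<Longrightarrow> b \<in> L \<Longrightarrow> v \<in> V \<Longrightarrow> \<phi> (a - b) v = \<phi> a v - \<phi> b v"
  using add[of "a - b" b v] A.subspace_diff[OF L] by simp

lemma sum: "(\<And>i. i \<in> I \<Longrightarrow> a i \<in> L) \<Longrightarrow> v \<in> V \<Longrightarrow> \<phi> (\<Sum>i\<in>I. a i) v = (\<Sum>i\<in>I. \<phi> (a i) v)"
proof (induction I rule: infinite_finite_induct)
  case (insert i I)
  then have "(\<Sum>i\<in>I. a i) \<in> L" by (intro A.subspace_sum[OF L]) auto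
  with insert show ?case by (simp add: add)
qed (simp_all add: zero)

lemma linear_sum: "a \<in> L \<Longrightarrow> \<phi> a (\<Sum>i\<in>I. v i) = (\<Sum>i\<in>I. \<phi> a (v i))"
proof -
  assume "a \<in> L"
  then interpret f: Vector_Spaces.linear scaleV scaleV "\<phi> a" by (rule linear)
  show ?thesis by (rule f.sum)
qed

lemma linear_0: "a \<in> L \<Longrightarrow> \<phi> a 0 = 0"
  using linear_sum[of a _ "{}"] by simp

text \<open>Multiplicativity is used for one product of entries at a time, always on a component of
  \<open>u\<close> in \<open>U\<close>; hence each single product must lie in \<open>L\<close>.
  Linearity and an exchange of summations do the rest.\<close>

lemma matrix_act_mult:
  assumes M: "\<And>i j. i < n \<Longrightarrow> j < n \<Longrightarrow> M i j \<in> L" and N: "\<And>i j. i < n \<Longrightarrow> j < n \<Longrightarrow> N i j \<in> L"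
    and MN: "\<And>i j k. i < n \<Longrightarrow> j < n \<Longrightarrow> k < n \<Longrightarrow> M i j * N j k \<in> L"
    and u: "u \<in> direct_power n U"
  shows "matrix_act n (\<lambda>i j. \<phi> (M i j)) (matrix_act n (\<lambda>i j. \<phi> (N i j)) u)
    = matrix_act n (\<lambda>i k. \<phi> (\<Sum>j<n. M i j * N j k)) u"
proof
  fix i
  have uU: "u k \<in> U" if "k < n" for k using u that by (auto simp: direct_power_def)
  then have uV: "u k \<in> V" if "k < n" for k using U(2) that by blast
  have "(\<Sum>j<n. \<phi> (M i j) (\<Sum>k<n. \<phi> (N j k) (u k))) = (\<Sum>k<n. \<phi> (\<Sum>j<n. M i j * N j k) (u k))"
    if i: "i < n"
  proof -
    have "(\<Sum>j<n. \<phi> (M i j) (\<Sum>k<n. \<phi> (N j k) (u k))) = (\<Sum>j<n. \<Sum>k<n. \<phi> (M i j * N j k) (u k))"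
      using i M N MN uU by (intro sum.cong refl) (simp add: linear_sum mult)
    also have "\<dots> = (\<Sum>k<n. \<Sum>j<n. \<phi> (M i j * N j k) (u k))"
      by (rule sum.swap)
    also have "\<dots> = (\<Sum>k<n. \<phi> (\<Sum>j<n. M i j * N j k) (u k))"
      using i MN uV by (intro sum.cong refl sum[symmetric]) auto
    finally show ?thesis .
  qed
  then show "matrix_act n (\<lambda>i j. \<phi> (M i j)) (matrix_act n (\<lambda>i j. \<phi> (N i j)) u) i
    = matrix_act n (\<lambda>i k. \<phi> (\<Sum>j<n. M i j * N j k)) u i"
    by (simp add: matrix_act_def)
qed

lemma matrix_act_one:
  assumes u: "u \<in> direct_power n V"
  shows "matrix_act n (\<lambda>i k. \<phi> (of_bool (i = k))) u = u"
proof
  fix i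
  have uV: "u k \<in> V" if "k < n" for k using u that by (auto simp: direct_power_def)
  have "(\<Sum>k<n. \<phi> (of_bool (i = k)) (u k)) = (\<Sum>k<n. if i = k then u k else 0)"
    using uV by (intro sum.cong) (auto simp: zero one)
  then show "matrix_act n (\<lambda>i k. \<phi> (of_bool (i = k))) u i = u i"
    using u by (simp add: matrix_act_def direct_power_def)
qed

text \<open>Apply \<open>dim_image_defect_le\<close> to direct powers of \<open>V\<close> and
  \<open>U\<close>, with \<open>S\<close>, \<open>T\<close> and \<open>C\<close> given by the
  matrices \<open>N\<close>, \<open>M\<close> and \<open>1 - N M\<close>. A single entry of the last
  operator has no larger rank than the whole.\<close>

lemma dim_image_defect_entry_le:
  assumes M: "\<And>i j. i < n \<Longrightarrow> j < n \<Longrightarrow> M i j \<in> L" and N: "\<And>i j. i < n \<Longrightarrow> j < n \<Longrightarrow> N i j \<in> L"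
    and MN: "\<And>i j k. i < n \<Longrightarrow> j < n \<Longrightarrow> k < n \<Longrightarrow> M i j * N j k \<in> L"
    and NM: "\<And>i j k. i < n \<Longrightarrow> j < n \<Longrightarrow> k < n \<Longrightarrow> N i j * M j k \<in> L"
    and MN1: "\<And>i k. i < n \<Longrightarrow> k < n \<Longrightarrow> (\<Sum>j<n. M i j * N j k) = of_bool (i = k)"
    and pq: "p < n" "q < n"
  shows "V.dim (\<phi> (of_bool (p = q) - (\<Sum>j<n. N p j * M j q)) ` V) + 2 * n * V.dim U
    \<le> 2 * n * V.dim V"
proof -
  interpret P: vector_space "seq_scale scaleV" by (rule V.vector_space_seq_scale)
  interpret PV: vector_space_pair "seq_scale scaleV" scaleV ..
  interpret PP: vector_space_pair "seq_scale scaleV" "seq_scale scaleV" ..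
  let ?D = "\<lambda>i k. of_bool (i = k) - (\<Sum>j<n. N i j * M j k)"
  have one_L': "of_bool b \<in> L" for b
    using one_L A.subspace_0[OF L] by (cases b) auto
  have NM_L: "(\<Sum>j<n. N i j * M j k) \<in> L" if "i < n" "k < n" for i k
    using that NM by (intro A.subspace_sum[OF L]) auto
  have D: "?D i k \<in> L" if "i < n" "k < n" for i k
    using one_L' NM_L[OF that] by (intro A.subspace_diff[OF L])
  let ?X = "direct_power n V" and ?Y = "direct_power n U"
  let ?S = "matrix_act n (\<lambda>i j. \<phi> (N i j))" and ?T = "matrix_act n (\<lambda>i j. \<phi> (M i j))"
    and ?C = "matrix_act n (\<lambda>i j. \<phi> (?D i j))"
  have X: "finite_dim_subspace (seq_scale scaleV) ?X"
    using V by (rule V.finite_dim_direct_power)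
  have YX: "?Y \<subseteq> ?X"
    using U(2) by (auto simp: direct_power_def)
  have fdU: "finite_dim_subspace scaleV U"
    using V U by (rule V.finite_dim_subspace_subset)
  have C: "Vector_Spaces.linear (seq_scale scaleV) (seq_scale scaleV) ?C"
    using D linear by (intro V.linear_matrix_act) blast
  have "P.dim (?C ` ?X) + 2 * P.dim ?Y \<le> 2 * P.dim ?X"
  proof (rule P.dim_image_defect_le[OF X _ YX _ _ _ _ C])
    show "P.subspace ?Y" using U(1) by (rule V.subspace_direct_power)
    show "Vector_Spaces.linear (seq_scale scaleV) (seq_scale scaleV) ?S"
      using N linear by (intro V.linear_matrix_act) blast
    show "Vector_Spaces.linear (seq_scale scaleV) (seq_scale scaleV) ?T"
      using M linear by (intro V.linear_matrix_act) blast
    show "?S ` ?Y \<subseteq> ?X"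
      using U(2) N by (auto simp: direct_power_def matrix_act_def subset_iff
          intro!: V.subspace_sum[OF V_subspace] closed)
    fix u assume u: "u \<in> ?Y"
    then have uX: "u \<in> ?X" using YX by blast
    then have uV: "u k \<in> V" if "k < n" for k
      using that by (simp add: direct_power_def)
    have "?T (?S u) = matrix_act n (\<lambda>i k. \<phi> (\<Sum>j<n. M i j * N j k)) u"
      using M N MN u by (rule matrix_act_mult)
    also have "\<dots> = matrix_act n (\<lambda>i k. \<phi> (of_bool (i = k))) u"
      using MN1 by (simp add: matrix_act_def fun_eq_iff)
    finally show "?T (?S u) = u"
      using matrix_act_one[OF uX] by simp
    have "?C u = matrix_act n (\<lambda>i k. \<phi> (of_bool (i = k))) u
        - matrix_act n (\<lambda>i k. \<phi> (\<Sum>j<n. N i j * M j k)) u"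
      using one_L' NM_L uV by (auto simp: matrix_act_def fun_eq_iff diff simp flip: sum_subtractf)
    also have "matrix_act n (\<lambda>i k. \<phi> (\<Sum>j<n. N i j * M j k)) u = ?S (?T u)"
      using N M NM u by (rule matrix_act_mult[symmetric])
    finally show "?C u = u - ?S (?T u)"
      using matrix_act_one[OF uX] by (simp add: fun_eq_iff)
  qed
  \<comment> \<open>The entry at \<open>p\<close>, \<open>q\<close> is \<open>?C\<close> preceded by
    the inclusion of coordinate \<open>q\<close> and followed by the projection to coordinate
    \<open>p\<close>.\<close>
  moreover have "V.dim (\<phi> (?D p q) ` V) \<le> P.dim (?C ` ?X)"
  proof -
    have fdC: "finite_dim_subspace (seq_scale scaleV) (?C ` ?X)"
      using C X by (rule PP.dim_image_add_dim_kernel_le)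
    note c = PV.dim_image_add_dim_kernel_le[OF V.linear_component[of p] fdC]
    have sub: "V.subspace (\<phi> (?D p q) ` V)"
      using D[OF pq] linear V_subspace V.module_axioms
      by (meson Vector_Spaces.linear.axioms module_hom.subspace_image)
    have "\<phi> (?D p q) ` V \<subseteq> (\<lambda>f. f p) ` (?C ` ?X)"
    proof
      fix w assume "w \<in> \<phi> (?D p q) ` V"
      then obtain v where v: "v \<in> V" "w = \<phi> (?D p q) v" by blast
      define f where "f = (\<lambda>i. if i = q then v else 0)"
      have fX: "f \<in> ?X"
        using v(1) pq(2) V.subspace_0[OF V_subspace] by (auto simp: f_def direct_power_def)
      have "?C f p = (\<Sum>j<n. \<phi> (?D p j) (f j))"
        using pq(1) by (simp add: matrix_act_def)
      also have "\<dots> = (\<Sum>j<n. if j = q then w else 0)"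
        using D[OF pq(1)] v(2) by (intro sum.cong refl) (simp add: f_def linear_0)
      finally have "w = ?C f p" using pq(2) by simp
      then show "w \<in> (\<lambda>f. f p) ` (?C ` ?X)" using fX by blast
    qed
    then have "V.dim (\<phi> (?D p q) ` V) \<le> V.dim ((\<lambda>f. f p) ` (?C ` ?X))"
      using V.finite_dim_subspace_subset(2)[OF c(1) sub] by blast
    then show ?thesis using c(2) by simp
  qed
  ultimately show ?thesis
    using V.dim_direct_power[OF V, of n] V.dim_direct_power[OF fdU, of n] by simp
qed

lemma dim_le_of_sum_eq_one:
  assumes "finite I" and c: "c \<in> L" and x: "\<And>i. i \<in> I \<Longrightarrow> x i \<in> L" and y: "\<And>i. i \<in> I \<Longrightarrow> y i \<in> L"
    and cy: "\<And>i. i \<in> I \<Longrightarrow> c * y i \<in> L" and xcy: "\<And>i. i \<in> I \<Longrightarrow> x i * (c * y i) \<in> L"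
    and sum1: "(\<Sum>i\<in>I. x i * (c * y i)) = 1"
  shows "V.dim U \<le> card I * V.dim (\<phi> c ` V)"
proof -
  interpret VV: vector_space_pair scaleV scaleV ..
  show ?thesis
  proof (rule VV.dim_le_sum_images[where f = "\<lambda>i. \<phi> (x i)"])
    show "finite_dim_subspace scaleV (\<phi> c ` V)"
      using linear[OF c] V by (rule VV.dim_image_add_dim_kernel_le)
    fix u assume u: "u \<in> U"
    then have uV: "u \<in> V" using U(2) by blast
    have "u = \<phi> (\<Sum>i\<in>I. x i * (c * y i)) u"
      using uV by (simp add: sum1 one)
    also have "\<dots> = (\<Sum>i\<in>I. \<phi> (x i * (c * y i)) u)"
      using xcy uV by (rule sum)
    \<comment> \<open>The outer product is split first, so that both uses of \<open>mult\<close> act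
      on \<open>u\<close> itself; \<open>\<phi> (y i) u\<close> may leave \<open>U\<close>. This is
      why \<open>c * y i\<close> has to lie in \<open>L\<close>.\<close>
    also have "\<dots> = (\<Sum>i\<in>I. \<phi> (x i) (\<phi> c (\<phi> (y i) u)))"
      using c x y cy xcy u by (intro sum.cong) (simp_all add: mult)
    finally have "u = (\<Sum>i\<in>I. \<phi> (x i) (\<phi> c (\<phi> (y i) u)))" .
    then show "\<exists>r. (\<forall>i\<in>I. r i \<in> \<phi> c ` V) \<and> u = (\<Sum>i\<in>I. \<phi> (x i) (r i))"
      using closed[OF y uV] by (intro exI[of _ "\<lambda>i. \<phi> c (\<phi> (y i) u)"]) auto
  qed (use linear x \<open>finite I\<close> in auto)
qed

end

text \<open>Each \<open>\<psi> a\<close> is replaced by a linear extension of its restriction to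
  \<open>V\<close>. All conditions survive because they only involve values on \<open>V\<close>,
  which every \<open>\<psi> b\<close> preserves.\<close>

lemma almost_representation_linear:
  assumes "vector_space scaleA" "vector_space scaleV" "module.subspace scaleA L" "1 \<in> L"
    and rep: "almost_representation scaleA scaleV \<epsilon> L V \<psi>"
  obtains U \<phi> where "linear_almost_rep scaleA scaleV L V U \<phi>"
    and "(real (vector_space.dim scaleV V) - real (vector_space.dim scaleV U))
          / real (vector_space.dim scaleV V) < \<epsilon>"
proof -
  interpret A: vector_space scaleA by fact
  interpret V: vector_space scaleV by fact
  interpret VV: vector_space_pair scaleV scaleV ..
  from rep obtain U where fdV: "finite_dim_subspace scaleV V"
    and lin: "linear_map_to_End scaleA scaleV L V \<psi>"
    and U: "V.subspace U" "U \<subseteq> V" and one: "\<And>v. v \<in> V \<Longrightarrow> \<psi> 1 v = v"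
    and mult: "\<And>a b v. a \<in> L \<Longrightarrow> b \<in> L \<Longrightarrow> a * b \<in> L \<Longrightarrow> v \<in> U \<Longrightarrow> \<psi> a (\<psi> b v) = \<psi> (a * b) v"
    and small: "(real (V.dim V) - real (V.dim U)) / real (V.dim V) < \<epsilon>"
    unfolding almost_representation_def by blast
  have subV: "V.subspace V" using fdV by (simp add: finite_dim_subspace_def)
  have "\<exists>g. Vector_Spaces.linear scaleV scaleV g \<and> (\<forall>v\<in>V. g v = \<psi> a v)" if "a \<in> L" for a
    using lin that by (intro VV.linear_on_subspace_extend[OF subV])
      (auto simp: linear_map_to_End_def linear_endo_on_def)
  then obtain \<phi> where \<phi>: "\<And>a. a \<in> L \<Longrightarrow> Vector_Spaces.linear scaleV scaleV (\<phi> a)"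
    and \<phi>\<psi>: "\<And>a v. a \<in> L \<Longrightarrow> v \<in> V \<Longrightarrow> \<phi> a v = \<psi> a v"
    by metis
  have "linear_almost_rep scaleA scaleV L V U \<phi>"
  proof (intro linear_almost_rep.intro linear_almost_rep_axioms.intro)
    fix a b v
    assume ab: "a \<in> L" "b \<in> L" "a * b \<in> L" and v: "v \<in> U"
    have "v \<in> V" using v U(2) by blast
    moreover from this have "\<psi> b v \<in> V"
      using lin ab(2) by (auto simp: linear_map_to_End_def linear_endo_on_def)
    ultimately show "\<phi> a (\<phi> b v) = \<phi> (a * b) v"
      using ab v by (simp add: \<phi>\<psi> mult)
  qed (use assms(1-4) fdV U \<phi> lin in \<open>auto simp: \<phi>\<psi> one A.subspace_add A.subspace_scale
      linear_map_to_End_def linear_endo_on_def\<close>)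
  then show thesis using small by (rule that)
qed

section \<open>Simple algebras\<close>

text \<open>The finite sums of terms \<open>x * (c * y)\<close> form the two-sided ideal generated
  by \<open>c\<close>; it is nonzero, so by simplicity it contains 1.\<close>

lemma simple_algebra_sum_eq_one:
  fixes c :: "'a::ring_1"
  assumes "simple_algebra TYPE('a)" and "c \<noteq> 0"
  shows "\<exists>m x y. (\<Sum>i<m::nat. x i * (c * y i)) = 1"
proof -
  \<comment> \<open>Lists of pairs encode the sums: concatenation adds, and scaling one component
    multiplies from that side.\<close>
  define g where "g l = sum_list (map (\<lambda>(x, y). x * (c * y)) l)" for l
  have g: "g (k @ l) = g k + g l" "r * g l = g (map (\<lambda>(x, y). (r * x, y)) l)"
    "g l * r = g (map (\<lambda>(x, y). (x, y * r)) l)" "g [(1, 1)] = c" "g [] = 0"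
    for k l r
    by (simp_all add: g_def sum_list_const_mult sum_list_mult_const o_def case_prod_unfold mult.assoc
        flip: sum_list_const_mult sum_list_mult_const)
  have "two_sided_ideal (range g)"
    unfolding two_sided_ideal_def
  proof (intro conjI ballI allI)
    show "0 \<in> range g" by (metis g(5) rangeI)
    fix u v assume "u \<in> range g" "v \<in> range g"
    then obtain k l where "u = g k" "v = g l" by blast
    \<comment> \<open>The sign is absorbed into the left factors of the second list.\<close>
    then have "u - v = g (k @ map (\<lambda>(x, y). (- 1 * x, y)) l)"
      by (simp only: g(1) flip: g(2)) simp
    then show "u - v \<in> range g" by blast
  next
    fix r u assume "u \<in> range g"
    then show "r * u \<in> range g" "u * r \<in> range g"
      using g(2,3) by auto
  qed
  moreover have "c \<in> range g" by (metis g(4) rangeI)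
  ultimately have "range g = UNIV"
    using assms unfolding simple_algebra_def by blast
  then obtain l where l: "g l = 1" by (metis UNIV_I imageE)
  have "(\<Sum>i<length l. fst (l ! i) * (c * snd (l ! i))) = 1"
    using l by (simp add: g_def sum_list_sum_nth case_prod_unfold lessThan_atLeast0)
  then show ?thesis
    by (intro exI[of _ "length l"] exI[of _ "\<lambda>i. fst (l ! i)"] exI[of _ "\<lambda>i. snd (l ! i)"])
qed

section \<open>Stable finiteness by a dimension count\<close>

theorem theorem2:
  fixes scale :: "'k::field \<Rightarrow> 'a::ring_1 \<Rightarrow> 'a"
  assumes "unital_algebra scale"
    and "simple_algebra TYPE('a)"
    and "almost_has_finite_dim_reps scale"
  shows "stably_finite TYPE('a)"
  unfolding stably_finite_def
proof (intro allI impI ballI)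
  fix n :: nat and A B :: "'a mat"
  assume A: "A \<in> carrier_mat n n" and B: "B \<in> carrier_mat n n" and AB: "A * B = 1\<^sub>m n"
  interpret unital_algebra scale by fact
  let ?M = "\<lambda>i j. A $$ (i, j)" and ?N = "\<lambda>i j. B $$ (i, j)"
  have prod: "(P * Q) $$ (i, k) = (\<Sum>j<n. P $$ (i, j) * Q $$ (j, k))"
    if "P \<in> carrier_mat n n" "Q \<in> carrier_mat n n" "i < n" "k < n" for P Q :: "'a mat" and i k
    using that by (simp add: scalar_prod_def lessThan_atLeast0)
  have MN1: "(\<Sum>j<n. ?M i j * ?N j k) = of_bool (i = k)" if "i < n" "k < n" for i k
    using prod[OF A B that, symmetric] that by (simp add: AB)
  show "B * A = 1\<^sub>m n"
  proof (rule ccontr)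
    assume "B * A \<noteq> 1\<^sub>m n"
    then obtain p q where pq: "p < n" "q < n" and ne: "(B * A) $$ (p, q) \<noteq> of_bool (p = q)"
      using A B by (auto simp: mat_eq_iff split: if_splits)
    define c where "c = of_bool (p = q) - (\<Sum>j<n. ?N p j * ?M j q)"
    have "c \<noteq> 0"
      using ne prod[OF B A pq] by (simp add: c_def)
    then obtain m x y where sum1: "(\<Sum>i<m::nat. x i * (c * y i)) = 1"
      using simple_algebra_sum_eq_one assms(2) by blast
    \<comment> \<open>\<open>F\<close> collects every element that the argument touches. Since it
      contains 1, the triple products in \<open>G\<close> include the single elements and the
      products of two, as well as all \<open>x i * (c * y i)\<close>.\<close>
    define F where "F = {1, c} \<union> (\<lambda>(i, j). ?M i j) ` ({..<n} \<times> {..<n})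
      \<union> (\<lambda>(i, j). ?N i j) ` ({..<n} \<times> {..<n}) \<union> x ` {..<m} \<union> y ` {..<m}"
    define G where "G = (\<lambda>(f, g, h). f * (g * h)) ` (F \<times> F \<times> F)"
    define L where "L = span G"
    have "finite F" by (simp add: F_def)
    then have "finite G" by (simp add: G_def)
    then have fdL: "finite_dim_subspace scale L"
      unfolding finite_dim_subspace_def L_def using subspace_span by blast
    have F3: "f * (g * h) \<in> L" if "f \<in> F" "g \<in> F" "h \<in> F" for f g h
      unfolding L_def G_def using that by (intro span_base) force
    have F1: "1 \<in> F" by (simp add: F_def)
    have F2: "f * g \<in> L" if "f \<in> F" "g \<in> F" for f g
      using F3[OF F1 that] by simp
    have FL: "f \<in> L" if "f \<in> F" for f
      using F2[OF F1 that] by simp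
    have in_F: "c \<in> F" "i < n \<Longrightarrow> j < n \<Longrightarrow> ?M i j \<in> F" "i < n \<Longrightarrow> j < n \<Longrightarrow> ?N i j \<in> F"
      "l < m \<Longrightarrow> x l \<in> F" "l < m \<Longrightarrow> y l \<in> F" for i j l
      by (auto simp: F_def)
    \<comment> \<open>With this value the almost representation gives
      \<open>(2 * m * n + 1) * dim U > 2 * m * n * dim V\<close>, the exact opposite of the bound
      from the ranks. The summand 1 also keeps the denominator positive when
      \<open>m = 0\<close>.\<close>
    define \<epsilon> where "\<epsilon> = 1 / real (2 * m * n + 1)"
    have "\<epsilon> > 0" by (simp add: \<epsilon>_def del: of_nat_add of_nat_Suc of_nat_mult)
    then obtain V \<psi> where rep: "almost_representation scale fun_scale \<epsilon> L V \<psi>"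
      using assms(3) fdL FL[OF F1] unfolding almost_has_finite_dim_reps_def by blast
    have "subspace L" using fdL by (simp add: finite_dim_subspace_def)
    then obtain U \<phi> where lin: "linear_almost_rep scale fun_scale L V U \<phi>"
      and small: "(real (vector_space.dim fun_scale V) - real (vector_space.dim fun_scale U))
          / real (vector_space.dim fun_scale V) < \<epsilon>"
      using almost_representation_linear[OF vector_space_axioms vector_space_fun_scale _ _ rep] FL[OF F1]
      by blast
    interpret R: linear_almost_rep scale fun_scale L V U \<phi> by (rule lin)
    let ?D = "R.V.dim V" and ?d = "R.V.dim U" and ?r = "R.V.dim (\<phi> c ` V)"
    \<comment> \<open>In dimension 0 the quotient in \<open>small\<close> would be 0 by the
      convention for division and would say nothing; \<open>V \<noteq> {0}\<close> excludes
      this.\<close>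
    have "?D \<noteq> 0"
    proof
      assume "?D = 0"
      moreover obtain B where "finite B" "R.V.span B = V" "card B = ?D"
        using R.V by (rule R.V.finite_dim_subspaceE)
      ultimately show False
        using rep by (auto simp: almost_representation_def)
    qed
    have "?r + 2 * n * ?d \<le> 2 * n * ?D"
      unfolding c_def
      by (rule R.dim_image_defect_entry_le[where M = ?M])
        (use MN1 pq in_F FL F2 in \<open>simp_all\<close>)
    then have "m * ?r + m * (2 * n * ?d) \<le> m * (2 * n * ?D)"
      using mult_le_mono2 by (metis distrib_left)
    moreover have "?d \<le> m * ?r"
      using R.dim_le_of_sum_eq_one[of "{..<m}" c x y] sum1 in_F FL F2 F3 by simp
    \<comment> \<open>The rank bound for \<open>c\<close>, multiplied by \<open>m\<close>, absorbs
      \<open>?d \<le> m * ?r\<close>, which eliminates the rank.\<close>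
    ultimately have "?d + m * (2 * n * ?d) \<le> m * (2 * n * ?D)" by linarith
    then have "real (?d + m * (2 * n * ?d)) \<le> real (m * (2 * n * ?D))"
      by (rule of_nat_mono)
    then have "real (2 * m * n + 1) * real ?d \<le> (real (2 * m * n + 1) - 1) * real ?D"
      by (simp add: algebra_simps)
    moreover have "real ?D - real ?d < \<epsilon> * real ?D"
      using small \<open>?D \<noteq> 0\<close> by (simp add: pos_divide_less_eq)
    then have "real (2 * m * n + 1) * (real ?D - real ?d) < real (2 * m * n + 1) * (\<epsilon> * real ?D)"
      by (intro mult_strict_left_mono) (simp_all del: of_nat_add of_nat_Suc of_nat_mult)
    then have "real (2 * m * n + 1) * (real ?D - real ?d) < real ?D"
      by (simp add: \<epsilon>_def del: of_nat_add of_nat_Suc of_nat_mult)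
    ultimately show False by (simp add: algebra_simps)
  qed
qed

end
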